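(* Let $a>1$ and $b\in(-1/3,1/3)\setminus\{0\}$ be fixed real numbers. For an arbitrary $z\in\mathbb{C}$ with $|z|>|b|$ and $|z|\neq 1$, the following inequality holds: $$|q_n(z,a,b)|\leq\frac{|z|^n+1}{\bigl|1-|z|\bigr|}\;\frac{\Gamma(2n+a-1)}{|b|^n\,\Gamma(n+a-1)}\sqrt{\frac{(a-1)_n(2n+a-1)}{n!\,(a-1)}}\;e,\qquad n\in\mathbb{N}.$$ Let $\alpha,\beta\in\mathbb{C}$ be arbitrary. For the same $z$, the general solution $$u_n(z,a,b):=\alpha\,p_n(z,a,b)+\beta\,q_n(z,a,b),\qquad n\in\mathbb{Z}_+,$$ of the difference equation $$z\,u_n=a_{n-1}u_{n-1}+b_nu_n+a_nu_{n+1},\qquad n\in\mathbb{N},$$ satisfies the inequality $$|u_n(z,a,b)|\leq\left(|\alpha||z|^n+|\beta|\frac{|z|^n+1}{\bigl|1-|z|\bigr|}\right)\frac{\Gamma(2n+a-1)}{|b|^n\,\Gamma(n+a-1)}\sqrt{\frac{(a-1)_n(2n+a-1)}{n!\,(a-1)}}\;e,\qquad n\in\mathbb{N}.$$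
   Context: $\mathbb{N}$ denotes the positive integers, $\mathbb{Z}_+$ the non-negative integers; $e$ is Euler's number; $(u)_0:=1$, $(u)_k:=u(u+1)\cdots(u+k-1)$ for $k\in\mathbb{N}$, $u\in\mathbb{C}$. The generalized Bessel polynomials are $$y_n(x,a,b):={}_2F_0\left(-n,n+a-1;-;-\frac{x}{b}\right)=\sum_{j=0}^n\frac{(-n)_j(n+a-1)_j}{j!}\left(-\frac{x}{b}\right)^j,\qquad n\in\mathbb{Z}_+,$$ and the normalized Bessel polynomials are $$p_n(x)=p_n(x,a,b):=(-i)^n\sqrt{\frac{(a-1)_n(2n+a-1)}{n!\,(a-1)}}\;y_n(x,a,b),\qquad n\in\mathbb{Z}_+.$$ $\mathcal{S}$ denotes the linear functional on the space of complex polynomials determined by $\mathcal{S}(p_np_m)=\delta_{n,m}$ for all $n,m\in\mathbb{Z}_+$ (no complex conjugation). The polynomials of the second kind are $$q_n(z)=q_n(z,a,b):=\mathcal{S}_x\left(\frac{p_n(z,a,b)-p_n(x,a,b)}{z-x}\right),\qquad n\in\mathbb{Z}_+,$$ where the subscript $x$ means that $\mathcal{S}$ acts on a polynomial in the variable $x$. The coefficients of the difference equation are $$a_n:=\frac{bi}{2n+a}\sqrt{\frac{(n+1)(n+a-1)}{(2n+a+1)(2n+a-1)}},\qquad b_n:=-\frac{(a-2)b}{(2n+a)(2n+a-2)},\qquad n\in\mathbb{Z}_+,$$ where in the case $a=2$ one uses the limit value $b_0=-b/2$. *)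

theory Defs
  imports "HOL-Analysis.Analysis" "HOL-Computational_Algebra.Computational_Algebra"
begin

definition bessel_y :: "real \<Rightarrow> real \<Rightarrow> nat \<Rightarrow> complex poly" where
  "bessel_y a b n =
     (\<Sum>j\<le>n. smult (of_real (pochhammer (- real n) j * pochhammer (real n + a - 1) j / fact j))
                  ([:0, - 1 / of_real b:] ^ j))"

definition bessel_norm_const :: "real \<Rightarrow> nat \<Rightarrow> real" where
  "bessel_norm_const a n =
     sqrt (pochhammer (a - 1) n * (2 * real n + a - 1) / (fact n * (a - 1)))"

definition bessel_p :: "real \<Rightarrow> real \<Rightarrow> nat \<Rightarrow> complex poly" where
  "bessel_p a b n = smult ((- \<i>) ^ n * of_real (bessel_norm_const a n)) (bessel_y a b n)"

definition orthonormality_functional ::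
    "real \<Rightarrow> real \<Rightarrow> (complex poly \<Rightarrow> complex) \<Rightarrow> bool" where
  "orthonormality_functional a b S \<longleftrightarrow>
     Vector_Spaces.linear smult times S \<and>
     (\<forall>n m. S (bessel_p a b n * bessel_p a b m) = (if n = m then 1 else 0))"

definition bessel_S :: "real \<Rightarrow> real \<Rightarrow> complex poly \<Rightarrow> complex" where
  "bessel_S a b = (THE S. orthonormality_functional a b S)"

(* The division takes place in the polynomial ring in x, for fixed z; it is exact because z is
   a root of the dividend. The divisor [:z, -1:] is z - x. *)
definition bessel_q :: "real \<Rightarrow> real \<Rightarrow> nat \<Rightarrow> complex \<Rightarrow> complex" where
  "bessel_q a b n z =
     bessel_S a b (([:poly (bessel_p a b n) z:] - bessel_p a b n) div [:z, -1:])"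

definition coeff_a :: "real \<Rightarrow> real \<Rightarrow> nat \<Rightarrow> complex" where
  "coeff_a a b n =
     of_real b * \<i> / of_real (2 * real n + a) *
     of_real (sqrt ((real n + 1) * (real n + a - 1) /
                    ((2 * real n + a + 1) * (2 * real n + a - 1))))"

(* For n = 0 and a = 2 the general expression is 0/0; its limit as a tends to 2 is -b/2. *)
definition coeff_b :: "real \<Rightarrow> real \<Rightarrow> nat \<Rightarrow> complex" where
  "coeff_b a b n =
     of_real (if n = 0 \<and> a = 2 then - b / 2
              else - ((a - 2) * b / ((2 * real n + a) * (2 * real n + a - 2))))"

definition solves_difference_eq ::
    "real \<Rightarrow> real \<Rightarrow> complex \<Rightarrow> (nat \<Rightarrow> complex) \<Rightarrow> bool" where
  "solves_difference_eq a b z u \<longleftrightarrow>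
     (\<forall>n\<ge>1. z * u n = coeff_a a b (n - 1) * u (n - 1) + coeff_b a b n * u n
                       + coeff_a a b n * u (n + 1))"

definition bessel_u ::
    "real \<Rightarrow> real \<Rightarrow> complex \<Rightarrow> complex \<Rightarrow> complex \<Rightarrow> nat \<Rightarrow> complex" where
  "bessel_u a b \<alpha> \<beta> z n = \<alpha> * poly (bessel_p a b n) z + \<beta> * bessel_q a b n z"

end

theory Submission
  imports Defs
begin

text \<open>The functional \<open>S\<close> has the moments \<open>S(x^k) = (-b)^k / (a)_k\<close>: by the Chu--Vandermonde identity
  these annihilate every \<open>p_n\<close> with \<open>n \<ge> 1\<close>, and orthonormality then follows from the three-term
  recurrence. As \<open>a > 1\<close> and \<open>\<bar>b\<bar> < 1\<close>, all moments have modulus at most 1, so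
  \<open>S\<close> maps the divided difference of \<open>x^j\<close> at \<open>z\<close> to a number of modulus at most
  \<open>1 + \<bar>z\<bar> + \<dots> + \<bar>z\<bar>^(j-1) \<le> r^j / \<bar>1 - \<bar>z\<bar>\<bar>\<close>, where \<open>r = max 1 \<bar>z\<bar>\<close>. Weighting this
  with the coefficients of \<open>p_n\<close> and comparing each term with the leading one, through
  \<open>n!/j! \<le> (n+a-1+j)_(n-j)\<close>, leaves the factor \<open>\<Sum>j\<le>n. 1/(n-j)! \<le> e\<close>. The general solution is
  covered because \<open>a_n \<noteq> 0\<close>, \<open>p_0 = 1\<close>, \<open>q_0 = 0\<close> and \<open>q_1 \<noteq> 0\<close>.\<close>

section \<open>Linear functionals on polynomials, given by their moments\<close>

definition moment_functional :: "(nat \<Rightarrow> complex) \<Rightarrow> complex poly \<Rightarrow> complex" where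
  "moment_functional \<mu> f = (\<Sum>k\<le>degree f. coeff f k * \<mu> k)"

text \<open>Zero padding beyond the degree lets polynomials of different degrees be summed over one
  common range.\<close>

lemma moment_functional_eq_sum:
  assumes "degree f \<le> N"
  shows "moment_functional \<mu> f = (\<Sum>k\<le>N. coeff f k * \<mu> k)"
  unfolding moment_functional_def using assms
  by (intro sum.mono_neutral_left) (auto simp: coeff_eq_0)

lemma moment_functional_add:
  "moment_functional \<mu> (f + g) = moment_functional \<mu> f + moment_functional \<mu> g"
proof -
  define N where "N = max (degree f) (degree g)"
  have "degree (f + g) \<le> N" by (simp add: N_def degree_add_le_max)
  then show ?thesis
    using moment_functional_eq_sum[of f N \<mu>] moment_functional_eq_sum[of g N \<mu>]
      moment_functional_eq_sum[of "f + g" N \<mu>]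
    by (simp add: N_def sum.distrib distrib_right)
qed

lemma moment_functional_smult:
  "moment_functional \<mu> (smult c f) = c * moment_functional \<mu> f"
  using moment_functional_eq_sum[of "smult c f" "degree f" \<mu>]
  by (simp add: moment_functional_def sum_distrib_left mult.assoc)

lemma moment_functional_monom: "moment_functional \<mu> (monom c k) = c * \<mu> k"
proof -
  have "moment_functional \<mu> (monom c k) = (\<Sum>i\<le>k. (if k = i then c else 0) * \<mu> i)"
    using moment_functional_eq_sum[OF degree_monom_le[of c k], of \<mu>] by simp
  also have "\<dots> = (\<Sum>i\<le>k. if k = i then c * \<mu> i else 0)"
    by (intro sum.cong) auto
  also have "\<dots> = c * \<mu> k" by simp
  finally show ?thesis .
qed

lemma linear_poly_functional_iff:
  fixes S :: "complex poly \<Rightarrow> complex"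
  shows "Vector_Spaces.linear smult times S \<longleftrightarrow>
    (\<forall>f g. S (f + g) = S f + S g) \<and> (\<forall>c f. S (smult c f) = c * S f)"
proof -
  have "vector_space (smult :: complex \<Rightarrow> complex poly \<Rightarrow> complex poly)"
    by unfold_locales (simp_all add: smult_add_right smult_add_left)
  moreover have "vector_space (times :: complex \<Rightarrow> complex \<Rightarrow> complex)"
    by unfold_locales (simp_all add: algebra_simps)
  ultimately show ?thesis
    unfolding Vector_Spaces.linear_iff by simp
qed

lemma linear_moment_functional: "Vector_Spaces.linear smult times (moment_functional \<mu>)"
  by (simp add: linear_poly_functional_iff moment_functional_add moment_functional_smult)

section \<open>Divided differences\<close>

text \<open>The quotient (f(z) - f(x)) / (z - x) as a polynomial in x, the argument that
  \<open>bessel_q\<close> hands to the functional.\<close>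

definition divided_difference :: "complex \<Rightarrow> complex poly \<Rightarrow> complex poly" where
  "divided_difference z f = ([:poly f z:] - f) div [:z, -1:]"

lemma divided_difference_mult: "[:z, -1:] * divided_difference z f = [:poly f z:] - f"
proof -
  have "[:- z, 1:] dvd [:poly f z:] - f"
    by (simp add: poly_eq_0_iff_dvd[symmetric])
  \<comment> \<open>The factor theorem speaks of x - z, whereas the divisor is z - x.\<close>
  moreover have "[:z, -1:] = - [:- z, 1:]" by simp
  ultimately have "[:z, -1:] dvd [:poly f z:] - f" by (metis minus_dvd_iff)
  then show ?thesis unfolding divided_difference_def by (rule dvd_mult_div_cancel)
qed

text \<open>Cancelling the nonzero factor z - x turns each later rule about this quotient into a
  check by multiplication.\<close>

lemma divided_difference_unique:
  assumes "[:z, -1:] * g = [:poly f z:] - f"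
  shows "divided_difference z f = g"
proof -
  have "[:z, -1:] * divided_difference z f = [:z, -1:] * g"
    by (simp only: assms divided_difference_mult)
  then show ?thesis by (subst (asm) mult_cancel_left) simp
qed

lemma divided_difference_add:
  "divided_difference z (f + g) = divided_difference z f + divided_difference z g"
proof (rule divided_difference_unique)
  show "[:z, -1:] * (divided_difference z f + divided_difference z g) = [:poly (f + g) z:] - (f + g)"
    unfolding distrib_left divided_difference_mult by simp
qed

lemma divided_difference_smult:
  "divided_difference z (smult c f) = smult c (divided_difference z f)"
proof (rule divided_difference_unique)
  show "[:z, -1:] * smult c (divided_difference z f) = [:poly (smult c f) z:] - smult c f"
    unfolding mult_smult_right divided_difference_mult by (simp add: smult_diff_right)
qed

lemma divided_difference_const: "divided_difference z [:c:] = 0"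
  by (rule divided_difference_unique) simp

text \<open>Prepending 0 multiplies by x, and z f(z) - x f(x) = z (f(z) - f(x)) + (z - x) f(x). This
  drives both the monomial estimate and the recurrence of the second-kind polynomials.\<close>

lemma divided_difference_pCons_0:
  "divided_difference z (pCons 0 f) = smult z (divided_difference z f) + f"
proof (rule divided_difference_unique)
  have "[:z, -1:] * (smult z (divided_difference z f) + f)
      = smult z ([:poly f z:] - f) + [:z, -1:] * f"
    unfolding distrib_left mult_smult_right divided_difference_mult ..
  also have "\<dots> = [:poly (pCons 0 f) z:] - pCons 0 f"
    by (simp add: smult_diff_right)
  finally show "[:z, -1:] * (smult z (divided_difference z f) + f)
      = [:poly (pCons 0 f) z:] - pCons 0 f" .
qed

text \<open>With T_j the value for x^j, \<open>divided_difference_pCons_0\<close> gives T_(j+1) = z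
  T_j + \<mu>_j and T_0 = 0, so T_j is a sum of powers of z weighted by moments.\<close>

lemma moment_divided_difference_bound:
  assumes "\<And>k. norm (\<mu> k) \<le> 1"
  shows "norm (moment_functional \<mu> (divided_difference z (monom 1 j))) \<le> (\<Sum>l<j. norm z ^ l)"
proof (induction j)
  case 0
  then show ?case
    by (simp add: monom_0 divided_difference_const moment_functional_def)
next
  case (Suc j)
  let ?T = "\<lambda>j. moment_functional \<mu> (divided_difference z (monom 1 j))"
  have "?T (Suc j) = z * ?T j + \<mu> j"
    by (simp add: monom_Suc divided_difference_pCons_0 moment_functional_add
        moment_functional_smult moment_functional_monom)
  then have "norm (?T (Suc j)) \<le> norm z * norm (?T j) + norm (\<mu> j)"
    by (metis norm_mult norm_triangle_ineq)
  also have "\<dots> \<le> norm z * (\<Sum>l<j. norm z ^ l) + 1"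
    by (intro add_mono mult_left_mono Suc assms) auto
  also have "\<dots> = (\<Sum>l<Suc j. norm z ^ l)"
    by (subst sum.lessThan_Suc_shift) (simp add: sum_distrib_left)
  finally show ?case .
qed

section \<open>Functionals determined by their values on a basis\<close>

text \<open>Stated for any additive homogeneous map because it is applied to the functional composed
  with the divided difference.\<close>

lemma monom_functional_expansion:
  fixes S :: "complex poly \<Rightarrow> complex"
  assumes add: "\<And>f g. S (f + g) = S f + S g" and smult: "\<And>c f. S (smult c f) = c * S f"
    and "degree f \<le> n"
  shows "S f = (\<Sum>j\<le>n. coeff f j * S (monom 1 j))"
proof -
  have S0: "S 0 = 0" using smult[of 0 0] by simp
  have "f = (\<Sum>j\<le>n. smult (coeff f j) (monom 1 j))"
    using poly_as_sum_of_monoms'[OF \<open>degree f \<le> n\<close>] by (simp add: smult_monom)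
  then have "S f = S (\<Sum>j\<le>n. smult (coeff f j) (monom 1 j))" by simp
  also have "\<dots> = (\<Sum>j\<le>n. S (smult (coeff f j) (monom 1 j)))"
    using sum_comp_morphism[of S "\<lambda>j. smult (coeff f j) (monom 1 j)" "{..n}"] S0 add
    by (simp add: o_def)
  finally show ?thesis by (simp add: smult)
qed

text \<open>Induction on the degree: subtracting a suitable multiple of the \<open>p\<close> of
  equal degree removes the leading term.\<close>

lemma poly_functional_eqI:
  fixes S T :: "complex poly \<Rightarrow> complex"
  assumes S: "Vector_Spaces.linear smult times S" and T: "Vector_Spaces.linear smult times T"
    and deg: "\<And>n. degree (p n) = n" and nz: "\<And>n. p n \<noteq> 0" and eq: "\<And>n. S (p n) = T (p n)"
  shows "S = T"
proof
  fix f
  note lin = S[unfolded linear_poly_functional_iff] T[unfolded linear_poly_functional_iff]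
  have zero: "S 0 = 0" "T 0 = 0"
    using lin by (metis mult_zero_left smult_0_left)+
  show "S f = T f"
  proof (induction "degree f" arbitrary: f rule: less_induct)
    case less
    define c where "c = lead_coeff f / lead_coeff (p (degree f))"
    define g where "g = f - smult c (p (degree f))"
    have f: "f = g + smult c (p (degree f))" by (simp add: g_def)
    have "coeff g (degree f) = 0"
      using nz deg by (simp add: g_def c_def) (metis leading_coeff_0_iff)
    moreover have "degree g \<le> degree f"
      unfolding g_def by (intro degree_diff_le) (auto simp: deg intro: order.trans[OF degree_smult_le])
    \<comment> \<open>For constant \<open>f\<close> the degree cannot drop; the remainder is then
      zero.\<close>
    ultimately have "degree g < degree f \<or> g = 0"
      by (metis leading_coeff_0_iff le_neq_implies_less)
    then have "S g = T g" using less zero by auto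
    then show ?case using lin eq by (metis f)
  qed
qed

section \<open>Elementary estimates for sums, binomials and Pochhammer symbols\<close>

text \<open>In the closed form the numerator is at most 1 if r < 1 and at most r^j if r > 1; the
  maximum covers both.\<close>

lemma geometric_sum_bounds:
  fixes r :: real
  assumes "r \<ge> 0" "r \<noteq> 1"
  shows "(\<Sum>l<j. r ^ l) \<le> max r 1 ^ j / \<bar>1 - r\<bar>"
proof (cases "r < 1")
  case True
  then have "(\<Sum>l<j. r ^ l) = (1 - r ^ j) / (1 - r)"
    by (simp add: sum_gp_strict)
  also have "\<dots> \<le> 1 / (1 - r)" using True assms by (intro divide_right_mono) auto
  finally show ?thesis using True by (simp add: max_def)
next
  case False
  then have "(\<Sum>l<j. r ^ l) = (r ^ j - 1) / (r - 1)"
    using assms by (simp add: sum_gp_strict) (metis minus_diff_eq minus_divide_divide)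
  also have "\<dots> \<le> r ^ j / (r - 1)" using False assms by (intro divide_right_mono) auto
  finally show ?thesis using False assms by (simp add: max_def)
qed

lemma pochhammer_minus_nat_div_fact:
  "pochhammer (- real n) j / fact j = (- 1) ^ j * real (n choose j)"
  by (simp add: binomial_gbinomial gbinomial_pochhammer flip: power_mult_distrib)

text \<open>Subtracting in the reals avoids truncation; for j > n both binomials vanish.\<close>

lemma Suc_times_binomial_minus:
  "real (Suc j) * real (n choose Suc j) = (real n - real j) * real (n choose j)"
proof (cases "j \<le> n")
  case True
  have "real (Suc j * (n choose Suc j)) = real ((n - j) * (n choose j))"
    by (simp only: binomial_absorption binomial_absorb_comp)
  then show ?thesis using True by (simp only: of_nat_mult of_nat_diff)
qed (simp add: binomial_eq_0)

text \<open>Since n! = j! (1+j)_(n-j), two Pochhammer products are compared factor by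
  factor.\<close>

lemma pochhammer_ge_fact_quotient:
  assumes "x \<ge> 1" "j \<le> n"
  shows "fact n \<le> fact j * pochhammer (x + real j) (n - j)"
proof -
  have "pochhammer (1 + real j) (n - j) \<le> pochhammer (x + real j) (n - j)"
    unfolding pochhammer_prod using assms by (intro prod_mono) auto
  then have "fact j * pochhammer (1 + real j) (n - j) \<le> fact j * pochhammer (x + real j) (n - j)"
    by (intro mult_left_mono) auto
  moreover have "(fact n :: real) = fact j * pochhammer (1 + real j) (n - j)"
    unfolding pochhammer_fact using pochhammer_product[OF \<open>j \<le> n\<close>, of "1 :: real"] by simp
  ultimately show ?thesis by simp
qed

text \<open>Splitting (x)_n = (x)_j (x+j)_(n-j) measures term j against the last term, with relative
  weight 1/(n-j)!.\<close>

lemma choose_pochhammer_le: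
  assumes "x \<ge> 1" "j \<le> n"
  shows "real (n choose j) * pochhammer x j \<le> pochhammer x n / fact (n - j)"
proof -
  have "pochhammer x j * fact n \<le> pochhammer x j * (fact j * pochhammer (x + real j) (n - j))"
    using assms by (intro mult_left_mono pochhammer_ge_fact_quotient pochhammer_nonneg) auto
  also have "\<dots> = fact j * pochhammer x n"
    using pochhammer_product[OF assms(2), of x] by simp
  finally show ?thesis
    using assms(2) by (simp add: binomial_fact field_simps)
qed

text \<open>As t \<ge> 1, each t^j may be raised to t^n; what remains is a partial sum of the series
  of e in reverse order.\<close>

lemma sum_choose_pochhammer_le:
  assumes "x \<ge> 1" "t \<ge> 1"
  shows "(\<Sum>j\<le>n. real (n choose j) * pochhammer x j * t ^ j) \<le> pochhammer x n * t ^ n * exp 1"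
proof -
  have pos: "pochhammer x n \<ge> 0" using assms by (intro pochhammer_nonneg) auto
  have "(\<Sum>j\<le>n. real (n choose j) * pochhammer x j * t ^ j)
      \<le> (\<Sum>j\<le>n. pochhammer x n / fact (n - j) * t ^ n)"
    using assms pos
    by (intro sum_mono mult_mono choose_pochhammer_le power_increasing) auto
  also have "\<dots> = pochhammer x n * t ^ n * (\<Sum>j\<le>n. 1 / fact (n - j))"
    by (simp add: sum_distrib_left)
  also have "(\<Sum>j\<le>n. 1 / fact (n - j) :: real) = (\<Sum>j\<le>n. 1 / fact j)"
    by (rule sum.nat_diff_reindex[of "\<lambda>j. 1 / fact j" "Suc n", simplified lessThan_Suc_atMost, simplified])
  also have "(\<Sum>j\<le>n. 1 / fact j :: real) \<le> exp 1"
    using sum_le_suminf[of "\<lambda>j. 1 / fact j :: real" "{..n}"]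
      summable_exp[of "1 :: real"]
    by (simp add: exp_def inverse_eq_divide)
  finally show ?thesis using pos assms by (simp add: mult_left_mono)
qed

section \<open>Coefficients and normalization of the Bessel polynomials\<close>

locale bessel_parameters =
  fixes a b :: real
  assumes a_gt_1: "a > 1" and b_nonzero: "b \<noteq> 0"
begin

text \<open>The sign of (-n)_j / j! = (-1)^j C(n,j) cancels against that of (-1/b)^j. The formula
  also covers j > n, where the binomial is 0.\<close>

lemma coeff_bessel_y:
  "coeff (bessel_y a b n) j =
    of_real (real (n choose j) * pochhammer (real n + a - 1) j / b ^ j)"
proof -
  have monomial: "[:0, c:] ^ k = monom (c ^ k) k" for c :: complex and k
    by (metis monom_0 monom_Suc monom_power mult_1 One_nat_def)
  have summand: "of_real (pochhammer (- real n) j * pochhammer (real n + a - 1) j / fact j)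
      * (- 1 / of_real b) ^ j
    = (of_real (real (n choose j) * pochhammer (real n + a - 1) j / b ^ j) :: complex)"
  proof -
    have "pochhammer (- real n) j * pochhammer (real n + a - 1) j / fact j * (- 1 / b) ^ j
      = (pochhammer (- real n) j / fact j) * (- 1 / b) ^ j * pochhammer (real n + a - 1) j"
      by simp
    also have "\<dots> = ((- 1) * (- 1 / b)) ^ j * real (n choose j) * pochhammer (real n + a - 1) j"
      unfolding pochhammer_minus_nat_div_fact power_mult_distrib by simp
    finally have "pochhammer (- real n) j * pochhammer (real n + a - 1) j / fact j * (- 1 / b) ^ j
      = real (n choose j) * pochhammer (real n + a - 1) j / b ^ j"
      by (simp add: power_divide)
    from arg_cong[OF this, of "of_real :: real \<Rightarrow> complex"] show ?thesis
      unfolding of_real_mult of_real_power by simp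
  qed
  have "coeff (bessel_y a b n) j = (\<Sum>k\<le>n. if k = j then
      of_real (pochhammer (- real n) k * pochhammer (real n + a - 1) k / fact k)
      * (- 1 / of_real b) ^ k else 0)"
    unfolding bessel_y_def coeff_sum monomial smult_monom coeff_monom by (intro sum.cong) auto
  also have "\<dots> = of_real (real (n choose j) * pochhammer (real n + a - 1) j / b ^ j)"
    unfolding sum.delta[OF finite_atMost] atMost_iff summand by (simp add: binomial_eq_0)
  finally show ?thesis .
qed

lemma bessel_norm_const_pos: "bessel_norm_const a n > 0"
proof -
  have "pochhammer (a - 1) n > 0" using a_gt_1 by (intro pochhammer_pos) auto
  then show ?thesis unfolding bessel_norm_const_def using a_gt_1
    by (intro real_sqrt_gt_zero divide_pos_pos mult_pos_pos) auto
qed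

lemma bessel_norm_const_0: "bessel_norm_const a 0 = 1"
  using a_gt_1 by (simp add: bessel_norm_const_def)

lemma bessel_norm_const_Suc:
  "bessel_norm_const a (Suc n) = bessel_norm_const a n *
     sqrt ((real n + a - 1) * (2 * real n + a + 1) / ((real n + 1) * (2 * real n + a - 1)))"
  unfolding bessel_norm_const_def real_sqrt_mult[symmetric] using a_gt_1
  by (simp add: pochhammer_Suc divide_simps) (simp add: algebra_simps)

text \<open>The root in a_n is a rational multiple of the quotient of consecutive normalizing
  constants. The resulting rational factors are those that carry the recurrence of y_n over to
  p_n.\<close>

lemma coeff_a_norm_const:
  "coeff_a a b n * of_real (bessel_norm_const a (Suc n)) =
     \<i> * of_real (b * (real n + a - 1) / ((2 * real n + a) * (2 * real n + a - 1))
       * bessel_norm_const a n)" (is ?up)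
  "coeff_a a b n * of_real (bessel_norm_const a n) =
     \<i> * of_real (b * (real n + 1) / ((2 * real n + a) * (2 * real n + a + 1))
       * bessel_norm_const a (Suc n))" (is ?down)
proof -
  let ?w = "sqrt ((real n + a - 1) * (2 * real n + a + 1) / ((real n + 1) * (2 * real n + a - 1)))"
  let ?s = "sqrt ((real n + 1) * (real n + a - 1) / ((2 * real n + a + 1) * (2 * real n + a - 1)))"
  have ww: "?w * ?w = (real n + a - 1) * (2 * real n + a + 1) / ((real n + 1) * (2 * real n + a - 1))"
    using a_gt_1 by simp
  have s: "?s = (real n + 1) / (2 * real n + a + 1) * ?w"
  proof (rule real_sqrt_unique)
    show "((real n + 1) / (2 * real n + a + 1) * ?w)\<^sup>2
        = (real n + 1) * (real n + a - 1) / ((2 * real n + a + 1) * (2 * real n + a - 1))"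
      unfolding power_mult_distrib using a_gt_1
      by (simp add: divide_simps power2_eq_square)
  qed (use a_gt_1 in simp)
  have sw: "?s * ?w = (real n + a - 1) / (2 * real n + a - 1)"
    unfolding s mult.assoc ww using a_gt_1 by (simp add: divide_simps)
  have A: "coeff_a a b n = \<i> * of_real (b / (2 * real n + a) * ?s)"
    by (simp add: coeff_a_def)
  have "b / (2 * real n + a) * ?s * bessel_norm_const a (Suc n)
      = b / (2 * real n + a) * (?s * ?w) * bessel_norm_const a n"
    by (simp only: bessel_norm_const_Suc mult_ac)
  also have "\<dots> = b * (real n + a - 1) / ((2 * real n + a) * (2 * real n + a - 1))
       * bessel_norm_const a n"
    unfolding sw by simp
  finally show ?up unfolding A by (simp only: mult.assoc flip: of_real_mult)
  have "b / (2 * real n + a) * ?s * bessel_norm_const a n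
      = b * (real n + 1) / ((2 * real n + a) * (2 * real n + a + 1)) * bessel_norm_const a (Suc n)"
    unfolding s bessel_norm_const_Suc by simp
  then show ?down unfolding A by (simp only: mult.assoc flip: of_real_mult)
qed

text \<open>Permits division by a_n, both for orthonormality and for uniqueness of
  solutions.\<close>

lemma coeff_a_nonzero: "coeff_a a b n \<noteq> 0"
proof
  assume "coeff_a a b n = 0"
  moreover have "b * (real n + 1) / ((2 * real n + a) * (2 * real n + a + 1))
      * bessel_norm_const a (Suc n) \<noteq> 0"
    using a_gt_1 b_nonzero bessel_norm_const_pos[of "Suc n"] by simp
  ultimately show False
    using coeff_a_norm_const(2)[of n]
    by (metis complex_i_not_zero mult_eq_0_iff mult_zero_left of_real_eq_0_iff)
qed

section \<open>The three-term recurrence\<close>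

text \<open>The recurrence of y_n at x^j, cleared of denominators and powers of b;
  \<open>d n (j - 1)\<close> stems from multiplication by x. For j > 0 all terms, times j, are
  multiples of C(n,j-1) (n+a-1)_(j-1), which leaves a polynomial identity in n, a and j.\<close>

lemma bessel_coefficient_recurrence:
  fixes n :: nat
  assumes "n \<ge> 1"
  defines "d \<equiv> \<lambda>n j. real (n choose j) * pochhammer (real n + a - 1) j"
  defines "N \<equiv> real n"
  shows "(N + a - 1) * (2 * N + a - 2) * d (Suc n) j =
    (2 * N + a) * (2 * N + a - 2) * (2 * N + a - 1) * (if j = 0 then 0 else d n (j - 1))
    + (a - 2) * (2 * N + a - 1) * d n j + N * (2 * N + a) * d (n - 1) j"
proof (cases j)
  case 0
  then show ?thesis by (simp add: d_def algebra_simps)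
next
  case (Suc i)
  define B where "B = real (n choose i)"
  define R where "R = pochhammer (N + a - 1) i"
  define J where "J = real j"
  have "J > 0" by (simp add: J_def Suc)
  have J: "real i = J - 1" by (simp add: J_def Suc)
  have b0: "J * real (n choose j) = (N - J + 1) * B"
    using Suc_times_binomial_minus[of i n] unfolding N_def B_def J_def Suc by simp
  have b1: "J * real (Suc n choose j) = (N + 1) * B"
    using arg_cong[OF Suc_times_binomial[of i n], of real] unfolding N_def B_def J_def Suc
    by (simp add: algebra_simps)
  have b2: "J * (N * real (n - 1 choose j)) = (N - J) * (N - J + 1) * B"
  proof -
    have "real n * real (n - 1 choose j) = real (Suc j) * real (n choose Suc j)"
      using arg_cong[OF binomial_absorption[of j n], of real] by (simp only: of_nat_mult)
    also have "\<dots> = (N - J) * real (n choose j)"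
      unfolding N_def J_def by (rule Suc_times_binomial_minus)
    finally have "N * real (n - 1 choose j) = (N - J) * real (n choose j)"
      by (simp only: N_def)
    then have "J * (N * real (n - 1 choose j)) = (N - J) * (J * real (n choose j))"
      by (simp only: mult_ac)
    then show ?thesis unfolding b0 by (simp only: mult_ac)
  qed
  have p0: "pochhammer (N + a - 1) j = R * (N + a + J - 2)"
    unfolding Suc pochhammer_Suc R_def J by (simp add: algebra_simps)
  \<comment> \<open>(N+a-1)_(j+1), split once at its first and once at its last factor.\<close>
  have p1: "(N + a - 1) * pochhammer (N + a) j = R * (N + a + J - 2) * (N + a + J - 1)"
  proof -
    have "(N + a - 1) * pochhammer (N + a) j = pochhammer (N + a - 1) (Suc j)"
      using pochhammer_rec[of "N + a - 1" j] by simp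
    also have "\<dots> = R * (N + a + J - 2) * (N + a + J - 1)"
      unfolding pochhammer_Suc[of _ j] p0 by (simp add: J_def algebra_simps)
    finally show ?thesis .
  qed
  have p2: "pochhammer (N + a - 2) j = (N + a - 2) * R"
    unfolding Suc pochhammer_rec R_def by simp
  have d1: "J * (N + a - 1) * d (Suc n) j = (N + 1) * B * R * (N + a + J - 2) * (N + a + J - 1)"
  proof -
    have "J * (N + a - 1) * d (Suc n) j
        = (J * real (Suc n choose j)) * ((N + a - 1) * pochhammer (N + a) j)"
      unfolding d_def N_def by (simp add: algebra_simps)
    then show ?thesis unfolding b1 p1 by simp
  qed
  have d0: "J * d n j = (N - J + 1) * B * R * (N + a + J - 2)"
  proof -
    have "J * d n j = (J * real (n choose j)) * pochhammer (N + a - 1) j"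
      by (simp add: d_def N_def)
    then show ?thesis unfolding b0 p0 by (simp only: mult_ac)
  qed
  have d2: "J * N * d (n - 1) j = (N - J) * (N - J + 1) * B * (N + a - 2) * R"
  proof -
    have "real (n - 1) + a - 1 = N + a - 2" using assms(1) by (simp add: N_def of_nat_diff)
    then have "d (n - 1) j = real (n - 1 choose j) * ((N + a - 2) * R)"
      unfolding d_def by (simp only: p2)
    then have "J * N * d (n - 1) j = (J * (N * real (n - 1 choose j))) * ((N + a - 2) * R)"
      by (simp only: mult_ac)
    then show ?thesis unfolding b2 by (simp only: mult_ac)
  qed
  have di: "d n (j - 1) = B * R" by (simp add: d_def B_def R_def Suc N_def)
  have "J * ((N + a - 1) * (2 * N + a - 2) * d (Suc n) j)
      = (2 * N + a - 2) * (J * (N + a - 1) * d (Suc n) j)" by simp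
  also have "\<dots> = J * (2 * N + a) * (2 * N + a - 2) * (2 * N + a - 1) * (B * R)
      + (a - 2) * (2 * N + a - 1) * (J * d n j) + (2 * N + a) * (J * N * d (n - 1) j)"
  proof -
    \<comment> \<open>What is left without the common factor \<open>B * R\<close>, which the next
      fact restores.\<close>
    have "(2 * N + a - 2) * ((N + 1) * ((N + a + J - 2) * (N + a + J - 1)))
        = J * ((2 * N + a) * ((2 * N + a - 2) * (2 * N + a - 1)))
          + (a - 2) * ((2 * N + a - 1) * ((N - J + 1) * (N + a + J - 2)))
          + (2 * N + a) * ((N - J) * ((N - J + 1) * (N + a - 2)))"
      by algebra
    moreover have "u * (B * R) = v * (B * R) + w * (B * R) + x * (B * R)" if "u = v + w + x"
      for u v w x
      by (simp only: that distrib_right)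
    ultimately show ?thesis
      unfolding d1 d0 d2 by (simp only: mult_ac)
  qed
  also have "\<dots> = J * ((2 * N + a) * (2 * N + a - 2) * (2 * N + a - 1) * d n (j - 1)
    + (a - 2) * (2 * N + a - 1) * d n j + N * (2 * N + a) * d (n - 1) j)"
    unfolding di by (simp add: algebra_simps)
  finally show ?thesis using \<open>J > 0\<close> by (simp add: Suc)
qed

lemma bessel_y_recurrence:
  fixes n :: nat
  assumes "n \<ge> 1"
  defines "N \<equiv> real n"
  shows "pCons 0 (bessel_y a b n) =
    smult (of_real (b * (N + a - 1) / ((2 * N + a) * (2 * N + a - 1)))) (bessel_y a b (Suc n))
    + smult (coeff_b a b n) (bessel_y a b n)
    - smult (of_real (b * N / ((2 * N + a - 1) * (2 * N + a - 2)))) (bessel_y a b (n - 1))"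
proof (rule poly_eqI)
  fix j
  define d where "d = (\<lambda>n j. real (n choose j) * pochhammer (real n + a - 1) j)"
  have y: "coeff (bessel_y a b n) j = of_real (d n j / b ^ j)" for n j
    by (simp add: coeff_bessel_y d_def)
  have nz: "2 * N + a \<noteq> 0" "2 * N + a - 1 \<noteq> 0" "2 * N + a - 2 \<noteq> 0"
    using assms a_gt_1 by (simp_all add: N_def)
  define P where "P = 2 * N + a"
  define Q where "Q = 2 * N + a - 1"
  define R where "R = 2 * N + a - 2"
  have nz': "P \<noteq> 0" "Q \<noteq> 0" "R \<noteq> 0" using nz by (simp_all add: P_def Q_def R_def)
  have "(N + a - 1) * R * d (Suc n) j =
    P * R * Q * (if j = 0 then 0 else d n (j - 1)) + (a - 2) * Q * d n j + N * P * d (n - 1) j"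
    using bessel_coefficient_recurrence[OF assms(1), of j]
    unfolding d_def N_def P_def Q_def R_def by simp
  then have "(if j = 0 then 0 else d n (j - 1)) =
     ((N + a - 1) * R * d (Suc n) j - (a - 2) * Q * d n j - N * P * d (n - 1) j) / (P * R * Q)"
    using nz' by (simp add: eq_divide_eq mult_ac)
  also have "\<dots> = (N + a - 1) / (P * Q) * d (Suc n) j - (a - 2) / (P * R) * d n j
      - N / (Q * R) * d (n - 1) j"
    using nz' by (simp add: divide_simps)
  \<comment> \<open>The coefficient shifted by x carries b^(-(j-1)) = b / b^j.\<close>
  finally have "(if j = 0 then 0 else d n (j - 1)) * (b / b ^ j) =
      ((N + a - 1) / (P * Q) * d (Suc n) j - (a - 2) / (P * R) * d n j
      - N / (Q * R) * d (n - 1) j) * (b / b ^ j)"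
    by simp
  then have rec: "(if j = 0 then 0 else d n (j - 1)) * (b / b ^ j) =
      (b * (N + a - 1) / (P * Q)) * (d (Suc n) j / b ^ j) - ((a - 2) * b / (P * R)) * (d n j / b ^ j)
      - (b * N / (Q * R)) * (d (n - 1) j / b ^ j)"
    unfolding left_diff_distrib by (simp add: mult_ac) (simp add: algebra_simps)
  have "coeff (pCons 0 (bessel_y a b n)) j
      = of_real ((if j = 0 then 0 else d n (j - 1)) * (b / b ^ j))"
    using b_nonzero by (cases j) (simp_all add: y)
  moreover have "coeff_b a b n = of_real (- ((a - 2) * b / (P * R)))"
    using assms(1) by (simp add: coeff_b_def P_def R_def N_def)
  ultimately show "coeff (pCons 0 (bessel_y a b n)) j = coeff
    (smult (of_real (b * (N + a - 1) / ((2 * N + a) * (2 * N + a - 1)))) (bessel_y a b (Suc n))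
    + smult (coeff_b a b n) (bessel_y a b n)
    - smult (of_real (b * N / ((2 * N + a - 1) * (2 * N + a - 2)))) (bessel_y a b (n - 1))) j"
    unfolding rec by (simp add: y P_def Q_def R_def)
qed

lemma bessel_p_0: "bessel_p a b 0 = 1"
  by (simp add: bessel_p_def bessel_y_def bessel_norm_const_0)

text \<open>Index 0 has no predecessor, so p_1 is written out explicitly.\<close>

lemma bessel_p_recurrence_0:
  "pCons 0 (bessel_p a b 0) = smult (coeff_b a b 0) (bessel_p a b 0)
    + smult (coeff_a a b 0) (bessel_p a b 1)"
proof -
  have "coeff_a a b 0 * of_real (bessel_norm_const a 1) = \<i> * of_real (b / a)"
    using coeff_a_norm_const(1)[of 0] a_gt_1 by (simp add: bessel_norm_const_0)
  \<comment> \<open>Cancelling a - 2 gives -b/a for a \<noteq> 2, and the limit value -b/2 at a = 2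
    has the same form.\<close>
  moreover have "coeff_b a b 0 = of_real (- b / a)"
    using a_gt_1 by (auto simp: coeff_b_def)
  moreover have "bessel_y a b 1 = [:1, of_real (a / b):]"
    by (rule poly_eqI) (auto simp: coeff_bessel_y coeff_pCons split: nat.splits)
  moreover have "smult (coeff_a a b 0) (bessel_p a b 1)
      = smult (- \<i> * (coeff_a a b 0 * of_real (bessel_norm_const a 1))) (bessel_y a b 1)"
    by (simp add: bessel_p_def mult_ac)
  ultimately show ?thesis using a_gt_1 b_nonzero
    by (simp add: bessel_p_0 one_pCons)
qed

text \<open>The phases (-i)^n turn the minus sign in the recurrence of y_n into a plus, so the same
  a_n serves upwards and downwards. Orthonormality rests on this symmetry.\<close>

lemma bessel_p_recurrence:
  assumes "n \<ge> 1"
  shows "pCons 0 (bessel_p a b n) = smult (coeff_a a b (n - 1)) (bessel_p a b (n - 1))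
    + smult (coeff_b a b n) (bessel_p a b n) + smult (coeff_a a b n) (bessel_p a b (Suc n))"
proof -
  let ?c = "\<lambda>n. (- \<i>) ^ n * of_real (bessel_norm_const a n)"
  let ?N = "real n"
  have up: "coeff_a a b n * ?c (Suc n)
      = ?c n * of_real (b * (?N + a - 1) / ((2 * ?N + a) * (2 * ?N + a - 1)))"
  proof -
    have "coeff_a a b n * ?c (Suc n)
        = (- \<i>) ^ n * (- \<i> * (coeff_a a b n * of_real (bessel_norm_const a (Suc n))))" by simp
    also have "\<dots> = (- \<i>) ^ n * of_real (b * (?N + a - 1) / ((2 * ?N + a) * (2 * ?N + a - 1))
        * bessel_norm_const a n)"
      unfolding coeff_a_norm_const by (simp flip: mult.assoc)
    finally show ?thesis by (simp only: of_real_mult mult_ac)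
  qed
  have down: "coeff_a a b (n - 1) * ?c (n - 1)
      = - (?c n * of_real (b * ?N / ((2 * ?N + a - 1) * (2 * ?N + a - 2))))"
  proof -
    obtain m where n: "n = Suc m" using assms by (cases n) auto
    have arg: "2 * real m + a + 1 = 2 * ?N + a - 1" "2 * real m + a = 2 * ?N + a - 2" "real m + 1 = ?N"
      by (simp_all add: n)
    have "coeff_a a b m * ?c m = (- \<i>) ^ m * (coeff_a a b m * of_real (bessel_norm_const a m))"
      by simp
    also have "\<dots> = - ((- \<i>) ^ Suc m * of_real (bessel_norm_const a (Suc m)
        * (b * (real m + 1) / ((2 * real m + a) * (2 * real m + a + 1)))))"
      unfolding coeff_a_norm_const by simp
    finally show ?thesis unfolding arg by (simp add: n mult_ac)
  qed
  have "pCons 0 (bessel_p a b n) = smult (?c n) (pCons 0 (bessel_y a b n))"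
    by (simp add: bessel_p_def)
  also have "\<dots> = smult (coeff_a a b n * ?c (Suc n)) (bessel_y a b (Suc n))
      + smult (coeff_b a b n) (smult (?c n) (bessel_y a b n))
      + smult (coeff_a a b (n - 1) * ?c (n - 1)) (bessel_y a b (n - 1))"
    unfolding bessel_y_recurrence[OF assms] up down
    by (simp add: smult_add_right smult_diff_right mult_ac)
  finally show ?thesis by (simp add: bessel_p_def add_ac)
qed

lemma bessel_p_nonzero: "bessel_p a b n \<noteq> 0" and degree_bessel_p: "degree (bessel_p a b n) = n"
proof -
  have pos: "pochhammer (real n + a - 1) n > 0" using a_gt_1 by (intro pochhammer_pos) auto
  have "coeff (bessel_p a b n) n \<noteq> 0"
    using pos b_nonzero bessel_norm_const_pos[of n] by (simp add: bessel_p_def coeff_bessel_y)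
  moreover have "degree (bessel_p a b n) \<le> n"
    by (rule degree_le) (simp add: bessel_p_def coeff_bessel_y binomial_eq_0)
  ultimately show "bessel_p a b n \<noteq> 0" "degree (bessel_p a b n) = n"
    using le_degree[of "bessel_p a b n" n] by auto
qed

section \<open>Moments and orthonormality\<close>

definition bessel_moment :: "nat \<Rightarrow> complex" where
  "bessel_moment k = of_real ((- b) ^ k / pochhammer a k)"

text \<open>For n > 0 the powers of b cancel and a terminating 2F1 at 1 with upper parameters n+a-1,
  -n and lower parameter a remains; Chu-Vandermonde evaluates it to (1-n)_n / (a)_n.\<close>

lemma moment_bessel_p:
  "moment_functional bessel_moment (bessel_p a b n) = (if n = 0 then 1 else 0)"
proof (cases "n = 0")
  case True
  then show ?thesis by (simp add: bessel_p_0 moment_functional_def bessel_moment_def)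
next
  case False
  have deg: "degree (bessel_y a b n) \<le> n"
    by (rule degree_le) (simp add: coeff_bessel_y binomial_eq_0)
  have "moment_functional bessel_moment (bessel_y a b n)
      = (\<Sum>j\<le>n. coeff (bessel_y a b n) j * bessel_moment j)"
    by (rule moment_functional_eq_sum[OF deg])
  also have "\<dots> = of_real (\<Sum>j\<le>n. real (n choose j) * pochhammer (real n + a - 1) j / b ^ j
      * ((- b) ^ j / pochhammer a j))"
    by (simp only: coeff_bessel_y bessel_moment_def of_real_sum of_real_mult)
  also have "(\<Sum>j\<le>n. real (n choose j) * pochhammer (real n + a - 1) j / b ^ j
      * ((- b) ^ j / pochhammer a j))
    = (\<Sum>j = 0..n. pochhammer (real n + a - 1) j * pochhammer (- real n) j
        / (of_nat (fact j) * pochhammer a j))"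
  proof (intro sum.cong)
    fix j
    have "pochhammer (- real n) j = fact j * ((- 1) ^ j * real (n choose j))"
      using pochhammer_minus_nat_div_fact[of n j] by (simp add: field_simps)
    moreover have "(- b) ^ j = (- 1) ^ j * b ^ j" by (metis mult_minus1 power_mult_distrib)
    ultimately show "real (n choose j) * pochhammer (real n + a - 1) j / b ^ j
        * ((- b) ^ j / pochhammer a j)
      = pochhammer (real n + a - 1) j * pochhammer (- real n) j
        / (of_nat (fact j) * pochhammer a j)"
      using b_nonzero by simp
  qed auto
  also have "\<dots> = pochhammer (a - (real n + a - 1)) n / pochhammer a n"
    using a_gt_1 by (intro Vandermonde_pochhammer) auto
  also have "a - (real n + a - 1) = - real (n - 1)"
    using False by (simp add: of_nat_diff)
  \<comment> \<open>The last factor is -(n-1) + (n-1) = 0.\<close>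
  also have "pochhammer (- real (n - 1)) n = 0"
    using False by (intro pochhammer_of_nat_eq_0_lemma) auto
  finally show ?thesis using False by (simp add: bessel_p_def moment_functional_smult)
qed

text \<open>Multiplication by the variable is symmetric for the form \<open>(f, g) \<mapsto> S (f g)\<close>, so the
  three-term recurrence transports orthonormality from index \<open>m\<close> to index \<open>m + 1\<close>.\<close>

lemma moment_orthonormal:
  "moment_functional bessel_moment (bessel_p a b n * bessel_p a b m) = (if n = m then 1 else 0)"
proof (induction m arbitrary: n rule: less_induct)
  case (less m)
  define L where "L = (\<lambda>n m. moment_functional bessel_moment (bessel_p a b n * bessel_p a b m))"
  \<comment> \<open>A lower coefficient 0 at index 0 merges both recurrences and makes the truncated
    \<open>n - 1\<close> harmless.\<close>
  define \<alpha> where "\<alpha> = (\<lambda>n. if n = 0 then 0 else coeff_a a b (n - 1))"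
  have rec: "pCons 0 (bessel_p a b n) = smult (\<alpha> n) (bessel_p a b (n - 1))
      + smult (coeff_b a b n) (bessel_p a b n) + smult (coeff_a a b n) (bessel_p a b (Suc n))" for n
    using bessel_p_recurrence_0 bessel_p_recurrence[of n] by (cases n) (simp_all add: \<alpha>_def)
  have left: "moment_functional bessel_moment (pCons 0 (bessel_p a b n) * bessel_p a b m)
      = \<alpha> n * L (n - 1) m + coeff_b a b n * L n m + coeff_a a b n * L (Suc n) m" for n m
    unfolding rec L_def by (simp only: distrib_right mult_smult_left moment_functional_add
        moment_functional_smult)
  have right: "moment_functional bessel_moment (pCons 0 (bessel_p a b n) * bessel_p a b m)
      = \<alpha> m * L n (m - 1) + coeff_b a b m * L n m + coeff_a a b m * L n (Suc m)" for n m
    using left[of m n] by (simp add: L_def mult.commute)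
  have IH: "L n k = (if n = k then 1 else 0)" if "k < m" for n k
    using less.IH[OF that] by (simp add: L_def)
  show ?case
  proof (cases m)
    case 0
    then show ?thesis by (simp add: bessel_p_0 moment_bessel_p)
  next
    case (Suc k)
    have "\<alpha> k * L n (k - 1) + coeff_b a b k * L n k + coeff_a a b k * L n (Suc k)
        = \<alpha> n * L (n - 1) k + coeff_b a b n * L n k + coeff_a a b n * L (Suc n) k"
      using left[of n k] right[of n k] by simp
    \<comment> \<open>By induction the values with second index k or k - 1 are Kronecker deltas. The
      diagonal terms (n = k) and those with n + 1 = k cancel; n = k + 1 leaves a_k.\<close>
    then have "coeff_a a b k * L n m = coeff_a a b k * (if n = m then 1 else 0)"
      unfolding Suc using Suc IH[of k] IH[of "k - 1"]
      by (cases k; cases n) (auto simp: \<alpha>_def split: if_splits)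
    then show ?thesis using coeff_a_nonzero[of k] by (simp add: L_def)
  qed
qed

text \<open>Existence is the orthonormality just shown; uniqueness comes from testing on the basis
  p_n.\<close>

lemma bessel_S_eq: "bessel_S a b = moment_functional bessel_moment"
  unfolding bessel_S_def
proof (rule the_equality)
  show "orthonormality_functional a b (moment_functional bessel_moment)"
    by (simp add: orthonormality_functional_def linear_moment_functional moment_orthonormal)
next
  fix S assume S: "orthonormality_functional a b S"
  \<comment> \<open>Orthonormality against p_0 = 1 prescribes the value on p_n itself.\<close>
  have "S (bessel_p a b n) = moment_functional bessel_moment (bessel_p a b n)" for n
    using S moment_orthonormal[of n 0] unfolding orthonormality_functional_def
    by (metis bessel_p_0 mult_1_right)
  then show "S = moment_functional bessel_moment"
    using S unfolding orthonormality_functional_def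
    by (intro poly_functional_eqI[where p = "bessel_p a b"] linear_moment_functional
        degree_bessel_p bessel_p_nonzero) auto
qed

section \<open>Second-kind polynomials and the difference equation\<close>

lemma bessel_q_eq:
  "bessel_q a b n z = moment_functional bessel_moment (divided_difference z (bessel_p a b n))"
  by (simp add: bessel_q_def bessel_S_eq divided_difference_def)

lemma bessel_p_solves: "solves_difference_eq a b z (\<lambda>n. poly (bessel_p a b n) z)"
  unfolding solves_difference_eq_def
proof (intro allI impI)
  fix n :: nat assume n: "n \<ge> 1"
  have "z * poly (bessel_p a b n) z = poly (pCons 0 (bessel_p a b n)) z" by simp
  then show "z * poly (bessel_p a b n) z = coeff_a a b (n - 1) * poly (bessel_p a b (n - 1)) z
      + coeff_b a b n * poly (bessel_p a b n) z + coeff_a a b n * poly (bessel_p a b (n + 1)) z"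
    unfolding bessel_p_recurrence[OF n] by simp
qed

text \<open>The functional sends the divided difference of x p_n to z q_n + S(p_n), and S(p_n) = 0
  for n \<ge> 1; so q_n inherits the recurrence of p_n.\<close>

lemma bessel_q_solves: "solves_difference_eq a b z (\<lambda>n. bessel_q a b n z)"
  unfolding solves_difference_eq_def
proof (intro allI impI)
  fix n :: nat assume n: "n \<ge> 1"
  have "z * bessel_q a b n z
      = moment_functional bessel_moment (divided_difference z (pCons 0 (bessel_p a b n)))"
    using n by (simp add: bessel_q_eq divided_difference_pCons_0 moment_functional_add
        moment_functional_smult moment_bessel_p)
  also have "\<dots> = coeff_a a b (n - 1) * bessel_q a b (n - 1) z
      + coeff_b a b n * bessel_q a b n z + coeff_a a b n * bessel_q a b (n + 1) z"
    unfolding bessel_p_recurrence[OF n] bessel_q_eq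
    by (simp add: divided_difference_add divided_difference_smult moment_functional_add
        moment_functional_smult)
  finally show "z * bessel_q a b n z = coeff_a a b (n - 1) * bessel_q a b (n - 1) z
      + coeff_b a b n * bessel_q a b n z + coeff_a a b n * bessel_q a b (n + 1) z" .
qed

lemma bessel_q_0: "bessel_q a b 0 z = 0"
  using divided_difference_const[of z 1]
  by (simp add: bessel_q_eq bessel_p_0 one_pCons moment_functional_def)

text \<open>The divided difference of the linear p_1 is its nonzero slope, and S(1) = 1.\<close>

lemma bessel_q_1: "bessel_q a b 1 z \<noteq> 0"
proof -
  have "degree (bessel_p a b 1) = 1" by (rule degree_bessel_p)
  then obtain c d where p: "bessel_p a b 1 = [:c, d:]"
    by (metis degree1_coeffs)
  then have "d \<noteq> 0" using \<open>degree (bessel_p a b 1) = 1\<close> by auto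
  have "divided_difference z [:c, d:] = [:d:]"
    by (rule divided_difference_unique) simp
  then show ?thesis using \<open>d \<noteq> 0\<close>
    unfolding bessel_q_eq p by (simp add: moment_functional_def bessel_moment_def)
qed

lemma solves_difference_eq_unique:
  assumes u: "solves_difference_eq a b z u" and v: "solves_difference_eq a b z v"
    and "u 0 = v 0" "u 1 = v 1"
  shows "u n = v n"
proof -
  \<comment> \<open>Two consecutive values are carried along since the recurrence has order
    two.\<close>
  have "u n = v n \<and> u (Suc n) = v (Suc n)"
  proof (induction n)
    case 0
    then show ?case using assms by simp
  next
    case (Suc n)
    have "coeff_a a b (Suc n) * u (Suc (Suc n)) = coeff_a a b (Suc n) * v (Suc (Suc n))"
      using u[unfolded solves_difference_eq_def, rule_format, of "Suc n"]
        v[unfolded solves_difference_eq_def, rule_format, of "Suc n"] Suc by auto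
    then show ?case using Suc coeff_a_nonzero by simp
  qed
  then show ?thesis ..
qed

lemma bessel_u_solves: "solves_difference_eq a b z (bessel_u a b \<alpha> \<beta> z)"
  unfolding solves_difference_eq_def
proof (intro allI impI)
  fix n :: nat assume n: "n \<ge> 1"
  note p = bessel_p_solves[of z, unfolded solves_difference_eq_def, rule_format, OF n]
  note q = bessel_q_solves[of z, unfolded solves_difference_eq_def, rule_format, OF n]
  have "z * bessel_u a b \<alpha> \<beta> z n = \<alpha> * (z * poly (bessel_p a b n) z) + \<beta> * (z * bessel_q a b n z)"
    by (simp add: bessel_u_def algebra_simps)
  then show "z * bessel_u a b \<alpha> \<beta> z n = coeff_a a b (n - 1) * bessel_u a b \<alpha> \<beta> z (n - 1)
      + coeff_b a b n * bessel_u a b \<alpha> \<beta> z n + coeff_a a b n * bessel_u a b \<alpha> \<beta> z (n + 1)"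
    unfolding p q by (simp add: bessel_u_def algebra_simps)
qed

lemma solves_difference_eq_iff:
  "solves_difference_eq a b z u \<longleftrightarrow> (\<exists>\<alpha> \<beta>. \<forall>n. u n = bessel_u a b \<alpha> \<beta> z n)"
proof
  assume u: "solves_difference_eq a b z u"
  \<comment> \<open>p_0 = 1 and q_0 = 0 force the first coefficient to be u_0; this \<beta> then
    matches index 1.\<close>
  define \<beta> where "\<beta> = (u 1 - u 0 * poly (bessel_p a b 1) z) / bessel_q a b 1 z"
  have "u n = bessel_u a b (u 0) \<beta> z n" for n
  proof (rule solves_difference_eq_unique[OF u bessel_u_solves])
    show "u 0 = bessel_u a b (u 0) \<beta> z 0" by (simp add: bessel_u_def bessel_p_0 bessel_q_0)
    show "u 1 = bessel_u a b (u 0) \<beta> z 1" using bessel_q_1[of z] by (simp add: bessel_u_def \<beta>_def)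
  qed
  then show "\<exists>\<alpha> \<beta>. \<forall>n. u n = bessel_u a b \<alpha> \<beta> z n" by blast
next
  assume "\<exists>\<alpha> \<beta>. \<forall>n. u n = bessel_u a b \<alpha> \<beta> z n"
  then obtain \<alpha> \<beta> where "u = bessel_u a b \<alpha> \<beta> z" by blast
  then show "solves_difference_eq a b z u" by (simp add: bessel_u_solves)
qed

section \<open>Norm estimates\<close>

lemma norm_bessel_moment:
  assumes "\<bar>b\<bar> \<le> 1"
  shows "norm (bessel_moment k) \<le> 1"
proof -
  have "1 \<le> pochhammer a k"
    unfolding pochhammer_prod using a_gt_1 by (intro prod_ge_1) auto
  moreover have "\<bar>b\<bar> ^ k \<le> 1" using assms by (intro power_le_one) auto
  ultimately have "\<bar>b\<bar> ^ k / pochhammer a k \<le> 1" by simp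
  then show ?thesis using \<open>1 \<le> pochhammer a k\<close>
    by (simp add: bessel_moment_def norm_divide norm_power del: of_real_divide of_real_power)
      (simp add: power_abs)
qed

text \<open>The factor shared by both inequalities: the modulus of the leading coefficient of p_n
  times e, with (n+a-1)_n written as a Gamma quotient.\<close>

definition bessel_bound :: "nat \<Rightarrow> real" where
  "bessel_bound n = Gamma (2 * real n + a - 1) / (\<bar>b\<bar> ^ n * Gamma (real n + a - 1))
    * bessel_norm_const a n * exp 1"

lemma bessel_bound_nonneg: "bessel_bound n \<ge> 0"
proof -
  have "Gamma (2 * real n + a - 1) > 0" "Gamma (real n + a - 1) > 0"
    using a_gt_1 by (auto intro: Gamma_real_pos)
  then show ?thesis using bessel_norm_const_pos[of n]
    by (simp add: bessel_bound_def)
qed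

text \<open>The radius stays free: r = |z| serves p_n and r = max(|z|, 1) serves q_n. From r \<ge>
  |b| follows r/|b| \<ge> 1, so the leading term controls the others.\<close>

lemma sum_norm_coeff_bessel_p_le:
  assumes "n \<ge> 1" "r \<ge> \<bar>b\<bar>"
  shows "(\<Sum>j\<le>n. norm (coeff (bessel_p a b n) j) * r ^ j) \<le> r ^ n * bessel_bound n"
proof -
  define x where "x = real n + a - 1"
  have x: "x \<ge> 1" using assms a_gt_1 by (simp add: x_def)
  have t: "r / \<bar>b\<bar> \<ge> 1" using assms b_nonzero by simp
  have "x \<notin> \<int>\<^sub>\<le>\<^sub>0" using x by (auto elim!: nonpos_Ints_cases)
  then have poch: "pochhammer x n = Gamma (2 * real n + a - 1) / Gamma (real n + a - 1)"
    using pochhammer_Gamma[of x n] by (simp add: x_def algebra_simps)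
  have coeff: "norm (coeff (bessel_p a b n) j) * r ^ j
      = bessel_norm_const a n * (real (n choose j) * pochhammer x j * (r / \<bar>b\<bar>) ^ j)" for j
  proof -
    have "pochhammer x j > 0" using x by (intro pochhammer_pos) auto
    then have "norm (coeff (bessel_y a b n) j) = real (n choose j) * pochhammer x j / \<bar>b\<bar> ^ j"
      unfolding coeff_bessel_y norm_of_real x_def by (simp add: abs_mult power_abs)
    then show ?thesis using bessel_norm_const_pos[of n]
      by (simp add: bessel_p_def norm_mult norm_power power_divide)
  qed
  have "(\<Sum>j\<le>n. norm (coeff (bessel_p a b n) j) * r ^ j)
      = bessel_norm_const a n * (\<Sum>j\<le>n. real (n choose j) * pochhammer x j * (r / \<bar>b\<bar>) ^ j)"
    unfolding coeff sum_distrib_left ..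
  also have "\<dots> \<le> bessel_norm_const a n * (pochhammer x n * (r / \<bar>b\<bar>) ^ n * exp 1)"
    using bessel_norm_const_pos[of n] x t
    by (intro mult_left_mono sum_choose_pochhammer_le) auto
  also have "\<dots> = r ^ n * bessel_bound n"
    unfolding poch bessel_bound_def by (simp add: power_divide mult_ac)
  finally show ?thesis .
qed

lemma norm_bessel_p_le:
  assumes "n \<ge> 1" "norm z \<ge> \<bar>b\<bar>"
  shows "norm (poly (bessel_p a b n) z) \<le> norm z ^ n * bessel_bound n"
proof -
  have "norm (poly (bessel_p a b n) z) = norm (\<Sum>j\<le>n. coeff (bessel_p a b n) j * z ^ j)"
    by (simp add: poly_altdef degree_bessel_p)
  also have "\<dots> \<le> (\<Sum>j\<le>n. norm (coeff (bessel_p a b n) j) * norm z ^ j)"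
    by (rule order.trans[OF norm_sum]) (simp add: norm_mult norm_power)
  also have "\<dots> \<le> norm z ^ n * bessel_bound n"
    by (rule sum_norm_coeff_bessel_p_le[OF assms])
  finally show ?thesis .
qed

lemma norm_bessel_q_le:
  assumes "n \<ge> 1" "\<bar>b\<bar> \<le> 1" "norm z \<noteq> 1"
  shows "norm (bessel_q a b n z) \<le> (norm z ^ n + 1) / \<bar>1 - norm z\<bar> * bessel_bound n"
proof -
  let ?r = "max (norm z) 1"
  let ?T = "\<lambda>f. moment_functional bessel_moment (divided_difference z f)"
  have "norm (bessel_q a b n z) = norm (\<Sum>j\<le>n. coeff (bessel_p a b n) j * ?T (monom 1 j))"
    unfolding bessel_q_eq
    by (subst monom_functional_expansion[of ?T _ n])
      (simp_all add: degree_bessel_p divided_difference_add divided_difference_smult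
        moment_functional_add moment_functional_smult)
  also have "\<dots> \<le> (\<Sum>j\<le>n. norm (coeff (bessel_p a b n) j) * norm (?T (monom 1 j)))"
    by (rule order.trans[OF norm_sum]) (simp add: norm_mult)
  also have "\<dots> \<le> (\<Sum>j\<le>n. norm (coeff (bessel_p a b n) j) * (?r ^ j / \<bar>1 - norm z\<bar>))"
  proof (intro sum_mono mult_left_mono)
    fix j
    have "norm (?T (monom 1 j)) \<le> (\<Sum>l<j. norm z ^ l)"
      by (intro moment_divided_difference_bound norm_bessel_moment assms)
    also have "\<dots> \<le> ?r ^ j / \<bar>1 - norm z\<bar>"
      using assms by (intro geometric_sum_bounds) auto
    finally show "norm (?T (monom 1 j)) \<le> ?r ^ j / \<bar>1 - norm z\<bar>" .
  qed auto
  also have "\<dots> = (\<Sum>j\<le>n. norm (coeff (bessel_p a b n) j) * ?r ^ j) / \<bar>1 - norm z\<bar>"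
    by (simp add: sum_divide_distrib)
  \<comment> \<open>Applicable because max(|z|, 1) \<ge> 1 \<ge> |b|.\<close>
  also have "\<dots> \<le> (?r ^ n * bessel_bound n) / \<bar>1 - norm z\<bar>"
    using assms by (intro divide_right_mono sum_norm_coeff_bessel_p_le) auto
  \<comment> \<open>max(|z|, 1)^n is |z|^n or 1, hence at most their sum; this is the source of the
    +1.\<close>
  also have "\<dots> \<le> ((norm z ^ n + 1) * bessel_bound n) / \<bar>1 - norm z\<bar>"
    by (intro divide_right_mono mult_right_mono bessel_bound_nonneg) (auto simp: max_def)
  finally show ?thesis by simp
qed

lemma norm_bessel_u_le:
  assumes "n \<ge> 1" "\<bar>b\<bar> \<le> 1" "norm z \<ge> \<bar>b\<bar>" "norm z \<noteq> 1"
  shows "norm (bessel_u a b \<alpha> \<beta> z n) \<le>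
    (norm \<alpha> * norm z ^ n + norm \<beta> * ((norm z ^ n + 1) / \<bar>1 - norm z\<bar>)) * bessel_bound n"
proof -
  have "norm (bessel_u a b \<alpha> \<beta> z n)
      \<le> norm \<alpha> * norm (poly (bessel_p a b n) z) + norm \<beta> * norm (bessel_q a b n z)"
    unfolding bessel_u_def by (metis norm_mult norm_triangle_ineq)
  also have "\<dots> \<le> norm \<alpha> * (norm z ^ n * bessel_bound n)
      + norm \<beta> * ((norm z ^ n + 1) / \<bar>1 - norm z\<bar> * bessel_bound n)"
    using assms by (intro add_mono mult_left_mono norm_bessel_p_le norm_bessel_q_le) auto
  finally show ?thesis by (simp only: distrib_right mult.assoc)
qed

end

theorem proposition1:
  fixes a b :: real and z :: complex
  assumes "a > 1"
    and "b \<in> {-1/3<..<1/3} - {0}"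
    and "norm z > \<bar>b\<bar>"
    and "norm z \<noteq> 1"
  shows "(\<forall>n\<ge>1. norm (bessel_q a b n z) \<le>
            (norm z ^ n + 1) / \<bar>1 - norm z\<bar>
            * (Gamma (2 * real n + a - 1) / (\<bar>b\<bar> ^ n * Gamma (real n + a - 1)))
            * sqrt (pochhammer (a - 1) n * (2 * real n + a - 1) / (fact n * (a - 1)))
            * exp 1)
       \<and> (\<forall>u. solves_difference_eq a b z u \<longleftrightarrow>
            (\<exists>\<alpha> \<beta>. \<forall>n. u n = bessel_u a b \<alpha> \<beta> z n))
       \<and> (\<forall>\<alpha> \<beta>. \<forall>n\<ge>1. norm (bessel_u a b \<alpha> \<beta> z n) \<le>
            (norm \<alpha> * norm z ^ n + norm \<beta> * ((norm z ^ n + 1) / \<bar>1 - norm z\<bar>))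
            * (Gamma (2 * real n + a - 1) / (\<bar>b\<bar> ^ n * Gamma (real n + a - 1)))
            * sqrt (pochhammer (a - 1) n * (2 * real n + a - 1) / (fact n * (a - 1)))
            * exp 1)"
proof -
  interpret bessel_parameters a b
    using assms by unfold_locales auto
  have b: "\<bar>b\<bar> \<le> 1" using assms by auto
  show ?thesis
  proof (intro conjI allI impI, goal_cases)
    case (1 n)
    with norm_bessel_q_le[OF 1 b assms(4)] show ?case
      by (simp only: bessel_bound_def bessel_norm_const_def mult.assoc)
  next
    case (2 u)
    show ?case by (rule solves_difference_eq_iff)
  next
    case (3 \<alpha> \<beta> n)
    with norm_bessel_u_le[OF 3 b less_imp_le[OF assms(3)] assms(4)] show ?case
      by (simp only: bessel_bound_def bessel_norm_const_def mult.assoc)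
  qed
qed

end
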